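(* Let $\mathfrak{g}=\mathfrak{a}\rtimes\mathfrak{s}$ be a finite-dimensional complex perfect Lie algebra (i.e. $[\mathfrak{g},\mathfrak{g}]=\mathfrak{g}$), where $\mathfrak{s}$ is semisimple and the solvable radical $\mathfrak{a}$ of $\mathfrak{g}$ is abelian. Assume that $\mathfrak{g}$ has no outer derivations, i.e., every derivation of $\mathfrak{g}$ is inner. Then any commutative post-Lie algebra structure on $\mathfrak{g}$ is trivial, i.e., $x\cdot y=0$ for all $x,y\in\mathfrak{g}$.
   Context: A commutative post-Lie algebra structure on a Lie algebra $\mathfrak{g}$ is a bilinear product $\mathfrak{g}\times\mathfrak{g}\to\mathfrak{g}$, $(x,y)\mapsto x\cdot y$, such that for all $x,y,z\in\mathfrak{g}$: $x\cdot y=y\cdot x$; $[x,y]\cdot z=x\cdot(y\cdot z)-y\cdot(x\cdot z)$; $x\cdot[y,z]=[x\cdot y,z]+[y,x\cdot z]$. *)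

theory Defs
  imports Complex_Main
begin

definition bilinear_product ::
    "('k::field \<Rightarrow> 'g::ab_group_add \<Rightarrow> 'g) \<Rightarrow> ('g \<Rightarrow> 'g \<Rightarrow> 'g) \<Rightarrow> bool" where
  "bilinear_product scale f \<longleftrightarrow>
     (\<forall>x. Vector_Spaces.linear scale scale (\<lambda>y. f x y)) \<and>
     (\<forall>y. Vector_Spaces.linear scale scale (\<lambda>x. f x y))"

locale lie_algebra = vector_space scale
  for scale :: "'k::field \<Rightarrow> 'g::ab_group_add \<Rightarrow> 'g" +
  fixes bracket :: "'g \<Rightarrow> 'g \<Rightarrow> 'g"
  assumes bracket_bilinear: "bilinear_product scale bracket"
    and bracket_self: "bracket x x = 0"
    and jacobi: "bracket x (bracket y z) + bracket y (bracket z x) + bracket z (bracket x y) = 0"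
begin

definition lie_subalgebra :: "'g set \<Rightarrow> bool" where
  "lie_subalgebra L \<longleftrightarrow> subspace L \<and> (\<forall>x\<in>L. \<forall>y\<in>L. bracket x y \<in> L)"

definition lie_ideal :: "'g set \<Rightarrow> 'g set \<Rightarrow> bool" where
  "lie_ideal I L \<longleftrightarrow> subspace I \<and> I \<subseteq> L \<and> (\<forall>x\<in>L. \<forall>y\<in>I. bracket x y \<in> I)"

definition lie_product :: "'g set \<Rightarrow> 'g set \<Rightarrow> 'g set" where
  "lie_product A B = span {bracket x y | x y. x \<in> A \<and> y \<in> B}"

primrec derived_series :: "'g set \<Rightarrow> nat \<Rightarrow> 'g set" where
  "derived_series L 0 = L"
| "derived_series L (Suc n) = lie_product (derived_series L n) (derived_series L n)"

definition lie_abelian :: "'g set \<Rightarrow> bool" where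
  "lie_abelian L \<longleftrightarrow> (\<forall>x\<in>L. \<forall>y\<in>L. bracket x y = 0)"

definition lie_solvable :: "'g set \<Rightarrow> bool" where
  "lie_solvable L \<longleftrightarrow> (\<exists>n. derived_series L n = {0})"

text \<open>The solvable radical of \<open>L\<close> is its largest solvable ideal. It is given as a relation,
  so that existence is not presupposed; uniqueness is immediate.\<close>

definition solvable_radical :: "'g set \<Rightarrow> 'g set \<Rightarrow> bool" where
  "solvable_radical R L \<longleftrightarrow>
     lie_ideal R L \<and> lie_solvable R \<and> (\<forall>I. lie_ideal I L \<and> lie_solvable I \<longrightarrow> I \<subseteq> R)"

text \<open>As usual, the zero algebra counts as semisimple.\<close>

definition lie_semisimple :: "'g set \<Rightarrow> bool" where
  "lie_semisimple L \<longleftrightarrow> lie_subalgebra L \<and> solvable_radical {0} L"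

definition lie_perfect :: "'g set \<Rightarrow> bool" where
  "lie_perfect L \<longleftrightarrow> lie_product L L = L"

text \<open>The whole algebra as the internal semidirect product of the ideal \<open>A\<close> and the
  subalgebra \<open>S\<close>.\<close>

definition semidirect_decomposition :: "'g set \<Rightarrow> 'g set \<Rightarrow> bool" where
  "semidirect_decomposition A S \<longleftrightarrow>
     lie_ideal A UNIV \<and> lie_subalgebra S \<and> A \<inter> S = {0} \<and> {a + s | a s. a \<in> A \<and> s \<in> S} = UNIV"

definition derivation :: "('g \<Rightarrow> 'g) \<Rightarrow> bool" where
  "derivation D \<longleftrightarrow> Vector_Spaces.linear scale scale D \<and>
     (\<forall>x y. D (bracket x y) = bracket (D x) y + bracket x (D y))"

definition inner_derivation :: "('g \<Rightarrow> 'g) \<Rightarrow> bool" where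
  "inner_derivation D \<longleftrightarrow> (\<exists>z. D = bracket z)"

definition commutative_post_lie :: "('g \<Rightarrow> 'g \<Rightarrow> 'g) \<Rightarrow> bool" where
  "commutative_post_lie p \<longleftrightarrow> bilinear_product scale p \<and>
     (\<forall>x y. p x y = p y x) \<and>
     (\<forall>x y z. p (bracket x y) z = p x (p y z) - p y (p x z)) \<and>
     (\<forall>x y z. p x (bracket y z) = bracket (p x y) z + bracket y (p x z))"

end

end

theory Submission
  imports Defs
begin

text \<open>
  As \<open>\<aa>\<close> is abelian, the projection onto \<open>\<aa>\<close> along \<open>\<ss>\<close> is a derivation. Being inner,
  it is \<open>ad z\<close> for some \<open>z\<close> whose \<open>\<ss>\<close>-component is central in \<open>\<ss>\<close>, hence zero; so the
  projection vanishes on \<open>\<aa>\<close> and \<open>\<aa> = 0\<close>. Thus the algebra has no nonzero abelian ideal.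

  Write \<open>x \<cdot> y = [T x, y]\<close>. The post-Lie axioms say that \<open>T\<close> is an endomorphism of the Lie algebra
  with \<open>[T x, y] = - [x, T y]\<close>. The Jacobi identity yields \<open>T\<^sup>4 = T\<^sup>2\<close>, and \<open>ker T\<^sup>2 = ker T\<close> because
  \<open>ker T \<inter> im T\<close> lies in the abelian ideal \<open>ker T \<inter> C(ker T)\<close>. So \<open>T\<^sup>3 = T\<close>, perfectness gives
  \<open>T\<^sup>2 = - T\<close>, and then \<open>2 [x, T y] = 0\<close> for all \<open>x\<close> and \<open>y\<close>.
\<close>

context lie_algebra
begin

section \<open>Calculation rules for the bracket\<close>

lemma linear_bracket_right: "Vector_Spaces.linear scale scale (bracket x)"
  and linear_bracket_left: "Vector_Spaces.linear scale scale (\<lambda>x. bracket x y)"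
  using bracket_bilinear by (auto simp: bilinear_product_def)

lemma additive_bracket_right: "Modules.additive (bracket x)"
  and additive_bracket_left: "Modules.additive (\<lambda>x. bracket x y)"
  using linear_bracket_right linear_bracket_left
  by (simp_all add: additive_def Vector_Spaces.linear_iff)

lemmas bracket_add_right = additive.add[OF additive_bracket_right]
lemmas bracket_add_left = additive.add[OF additive_bracket_left]
lemmas bracket_minus_right = additive.minus[OF additive_bracket_right]
lemmas bracket_minus_left = additive.minus[OF additive_bracket_left]
lemmas bracket_diff_right = additive.diff[OF additive_bracket_right]
lemmas bracket_diff_left = additive.diff[OF additive_bracket_left]
lemmas bracket_zero_right = additive.zero[OF additive_bracket_right]
lemmas bracket_zero_left = additive.zero[OF additive_bracket_left]

lemma bracket_scale_right: "bracket x (scale c y) = scale c (bracket x y)"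
  using linear_bracket_right by (simp add: Vector_Spaces.linear_iff)

lemma bracket_scale_left: "bracket (scale c x) y = scale c (bracket x y)"
  using linear_bracket_left by (simp add: Vector_Spaces.linear_iff)

lemmas bracket_simps =
  bracket_add_right bracket_add_left bracket_minus_right bracket_minus_left
  bracket_diff_right bracket_diff_left bracket_zero_right bracket_zero_left
  bracket_scale_right bracket_scale_left

lemma bracket_anticomm: "bracket x y = - bracket y x"
proof -
  have "bracket (x + y) (x + y) = bracket x y + bracket y x"
    by (simp only: bracket_add_left bracket_add_right) (simp add: bracket_self)
  then have "bracket x y + bracket y x = 0"
    unfolding bracket_self ..
  then show ?thesis
    by (simp add: eq_neg_iff_add_eq_0)
qed

lemma jacobi_left: "bracket (bracket x y) z = bracket x (bracket y z) - bracket y (bracket x z)"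
proof -
  have "bracket z (bracket x y) = - bracket (bracket x y) z"
    by (rule bracket_anticomm)
  moreover have "bracket y (bracket z x) = - bracket y (bracket x z)"
    by (subst bracket_anticomm[of z x]) (simp add: bracket_simps)
  ultimately show ?thesis
    using jacobi[of x y z] by (simp add: algebra_simps)
qed

section \<open>Abelian ideals and centres\<close>

lemma lie_abelian_imp_solvable:
  assumes "subspace I" "lie_abelian I"
  shows "lie_solvable I"
proof -
  have "{bracket x y | x y. x \<in> I \<and> y \<in> I} = {0}"
    using assms subspace_0[of I] bracket_self[of 0] by (force simp: lie_abelian_def)
  then have "derived_series I 1 = {0}"
    by (simp add: lie_product_def)
  then show ?thesis
    unfolding lie_solvable_def by blast
qed

lemma abelian_ideal_eq_0:
  assumes "solvable_radical {0} L" "lie_ideal I L" "lie_abelian I" "x \<in> I"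
  shows "x = 0"
proof -
  have "lie_solvable I"
    using assms(2,3) by (intro lie_abelian_imp_solvable) (simp_all add: lie_ideal_def)
  then have "I \<subseteq> {0}"
    using assms(1,2) by (simp add: solvable_radical_def)
  then show ?thesis
    using assms(4) by blast
qed

text \<open>The centre is an abelian ideal. Applied to \<open>S\<close> and to the whole algebra,
  where it makes \<open>ad\<close> injective.\<close>

lemma centre_eq_0:
  assumes "solvable_radical {0} L" "subspace L" "z \<in> L" "\<And>y. y \<in> L \<Longrightarrow> bracket z y = 0"
  shows "z = 0"
proof -
  let ?Z = "{z \<in> L. \<forall>y\<in>L. bracket z y = 0}"
  have "subspace ?Z"
    using assms(2) by (auto simp: subspace_def bracket_simps)
  moreover have "bracket x y = 0" if "x \<in> L" "y \<in> ?Z" for x y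
    using that bracket_anticomm[of x y] by simp
  ultimately have "lie_ideal ?Z L"
    by (simp add: lie_ideal_def subspace_0 bracket_zero_left \<open>subspace L\<close>)
  moreover have "lie_abelian ?Z"
    by (auto simp: lie_abelian_def)
  ultimately show ?thesis
    using assms by (intro abelian_ideal_eq_0[of L ?Z]) auto
qed

section \<open>The projection onto an abelian ideal\<close>

lemma abelian_complement_eq_0:
  assumes decomp: "semidirect_decomposition A S" and S: "lie_semisimple S"
    and A: "lie_abelian A"
    and inner: "\<And>D. derivation D \<Longrightarrow> inner_derivation D"
  shows "A = {0}"
proof -
  have subA: "subspace A" and subS: "subspace S"
    and ideal: "\<And>x y. y \<in> A \<Longrightarrow> bracket x y \<in> A"
    and closed: "\<And>x y. x \<in> S \<Longrightarrow> y \<in> S \<Longrightarrow> bracket x y \<in> S"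
    and disj: "A \<inter> S = {0}" and rad: "solvable_radical {0} S"
    and abel: "\<And>x y. x \<in> A \<Longrightarrow> y \<in> A \<Longrightarrow> bracket x y = 0"
    using decomp S A
    unfolding semidirect_decomposition_def lie_ideal_def lie_subalgebra_def
      lie_semisimple_def lie_abelian_def by blast+
  have ideal': "bracket x y \<in> A" if "x \<in> A" for x y
    using ideal[OF that, of y] bracket_anticomm[of x y] subspace_neg[OF subA] by simp
  have unique: "a = a'" if "a \<in> A" "a' \<in> A" "s \<in> S" "s' \<in> S" "a + s = a' + s'" for a a' s s'
  proof -
    have "a - a' = s' - s"
      using that(5) by (simp add: algebra_simps)
    then have "a - a' \<in> A \<inter> S"
      using that subspace_diff[OF subA] subspace_diff[OF subS] by (metis IntI)
    then show ?thesis
      using disj by simp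
  qed
  have "\<exists>a s. a \<in> A \<and> s \<in> S \<and> x = a + s" for x
    using decomp unfolding semidirect_decomposition_def by blast
  \<comment> \<open>\<open>D\<close> and \<open>C\<close> are the projections to \<open>A\<close>
    and \<open>S\<close>; values of \<open>D\<close> are then found by exhibiting a
    decomposition.\<close>
  then obtain D C where DC: "\<And>x. D x \<in> A" "\<And>x. C x \<in> S" "\<And>x. x = D x + C x"
    by metis
  have D_eq: "D x = a" if "a \<in> A" "s \<in> S" "x = a + s" for x a s
    using unique[of "D x" a "C x" s] DC that by metis
  have "derivation D"
    unfolding derivation_def Vector_Spaces.linear_iff
  proof (intro conjI allI)
    show "vector_space scale" "vector_space scale"
      by unfold_locales
    show "D (x + y) = D x + D y" for x y
    proof (rule D_eq)
      show "x + y = D x + D y + (C x + C y)"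
        using DC(3)[of x] DC(3)[of y] by (metis add.assoc add.left_commute)
    qed (simp_all add: DC(1,2) subA subS subspace_add)
    show "D (scale c x) = scale c (D x)" for c x
    proof (rule D_eq)
      show "scale c x = scale c (D x) + scale c (C x)"
        using DC(3)[of x] by (metis scale_right_distrib)
    qed (simp_all add: DC(1,2) subA subS subspace_scale)
    show "D (bracket x y) = bracket (D x) y + bracket x (D y)" for x y
    proof (rule D_eq)
      \<comment> \<open>The sum \<open>[D x, y] + [x, D y]\<close> counts \<open>[D x, D y]\<close>
        twice, which is harmless because \<open>A\<close> is abelian; the \<open>S\<close>-part of
        \<open>[x, y]\<close> is \<open>[C x, C y]\<close>.\<close>
      have "bracket x y = bracket (D x) y + bracket (C x) y"
        using DC(3)[of x] by (metis bracket_add_left)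
      moreover have "bracket (C x) y = bracket (C x) (D y) + bracket (C x) (C y)"
        using DC(3)[of y] by (metis bracket_add_right)
      moreover have "bracket x (D y) = bracket (D x) (D y) + bracket (C x) (D y)"
        using DC(3)[of x] by (metis bracket_add_left)
      ultimately show "bracket x y = bracket (D x) y + bracket x (D y) + bracket (C x) (C y)"
        using abel[OF DC(1) DC(1), of x y] by (simp add: add.assoc)
    qed (simp_all add: DC(1,2) subA subspace_add ideal ideal' closed)
  qed
  then obtain z where z: "D = bracket z"
    using inner unfolding inner_derivation_def by blast
  \<comment> \<open>\<open>D\<close> kills \<open>S\<close>, so \<open>[C z, s] = - [D z, s]\<close>
    lies in both \<open>S\<close> and \<open>A\<close>.\<close>
  have "C z = 0"
  proof (rule centre_eq_0[OF rad subS DC(2)])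
    fix s assume s: "s \<in> S"
    have "bracket (D z) s + bracket (C z) s = bracket z s"
      using DC(3)[of z] by (metis bracket_add_left)
    also have "\<dots> = 0"
      using D_eq[of 0 s s] s subspace_0[OF subA] by (simp add: z[symmetric])
    finally have "bracket (C z) s = - bracket (D z) s"
      by (simp add: add_eq_0_iff)
    then have "bracket (C z) s \<in> A"
      using DC(1) ideal' subspace_neg[OF subA] by simp
    then show "bracket (C z) s = 0"
      using closed[OF DC(2) s] disj by blast
  qed
  then have "z \<in> A"
    using DC(1)[of z] DC(3)[of z] by simp
  have "a = 0" if "a \<in> A" for a
  proof -
    have "a = D a"
      using D_eq[of a 0 a] that subspace_0[OF subS] by simp
    also have "\<dots> = 0"
      using abel[OF \<open>z \<in> A\<close> that] by (simp add: z)
    finally show ?thesis .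
  qed
  then show ?thesis
    using subspace_0[OF subA] by auto
qed

section \<open>Skew endomorphisms of a perfect algebra with zero radical\<close>

lemma skew_endomorphism_eq_0:
  assumes char: "(2::'k) \<noteq> 0" and perfect: "lie_perfect UNIV"
    and rad: "solvable_radical {0} UNIV"
    and lin: "Vector_Spaces.linear scale scale T"
    and hom: "\<And>x y. T (bracket x y) = bracket (T x) (T y)"
    and skew: "\<And>x y. bracket (T x) y = - bracket x (T y)"
  shows "T x = 0"
proof -
  have centre: "z = 0" if "\<And>y. bracket z y = 0" for z
    using centre_eq_0[OF rad subspace_UNIV] that by blast
  have T_add: "T (x + y) = T x + T y" and T_scale: "T (scale c x) = scale c (T x)" for c x y
    using lin by (simp_all add: Vector_Spaces.linear_iff)
  have "additive T"
    by (simp add: additive_def T_add)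
  then have T_diff: "T (x - y) = T x - T y" and T_minus: "T (- x) = - T x"
    and T_0: "T 0 = 0" for x y
    by (simp_all add: additive.diff additive.minus additive.zero)
  \<comment> \<open>As rewrite rules, \<open>skew\<close> moves \<open>T\<close> to the right and
    \<open>pull\<close> moves it to the left.\<close>
  have pull: "bracket x (T y) = - bracket (T x) y" for x y
    by (simp add: skew)

  have T4: "T (T (T (T x))) = T (T x)" for x
  proof -
    \<comment> \<open>On \<open>[x, [y, z]]\<close> the operator \<open>T\<close> acts on \<open>y\<close> as \<open>-T\<close> on \<open>z\<close>, and on \<open>[y, [x, z]]\<close> it acts on
      \<open>x\<close> as \<open>-T\<close> on \<open>z\<close>. So \<open>(T\<^sub>y + T\<^sub>z) (T\<^sub>x + T\<^sub>z)\<close> kills both, hence also \<open>[[x, y], z]\<close>.\<close>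
    have "bracket (bracket (T (T (T (T x))) - T (T x)) y) z = 0" for y z
    proof -
      have "bracket (bracket (T x) (T y)) z + bracket (bracket x (T y)) (T z)
          + bracket (bracket (T x) y) (T z) + bracket (bracket x y) (T (T z)) = 0"
        unfolding jacobi_left by (simp add: skew bracket_simps)
      \<comment> \<open>Once every \<open>T\<close> is moved onto \<open>x\<close>, the outer terms
        give \<open>T\<^sup>4 x - T\<^sup>2 x\<close> and the two middle ones cancel, as both
        involve \<open>T\<^sup>3 x\<close> with opposite signs.\<close>
      then show ?thesis
        by (simp add: pull hom T_minus bracket_simps)
    qed
    then have "T (T (T (T x))) - T (T x) = 0"
      by (rule centre[OF centre])
    then show ?thesis
      by simp
  qed

  have ker: "T u = 0" if "T (T u) = 0" for u
  proof -
    \<comment> \<open>The centre of the ideal \<open>ker T\<close>; Jacobi makes it an ideal of the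
      whole algebra. It contains \<open>T u\<close>, since \<open>[T u, v] = - [u, T v] = 0\<close>
      for \<open>v\<close> in \<open>ker T\<close>.\<close>
    let ?I = "{u. T u = 0 \<and> (\<forall>v. T v = 0 \<longrightarrow> bracket u v = 0)}"
    have "lie_ideal ?I UNIV"
      by (auto simp: lie_ideal_def subspace_def T_0 T_add T_scale hom jacobi_left bracket_simps)
    moreover have "lie_abelian ?I"
      by (auto simp: lie_abelian_def)
    moreover have "T u \<in> ?I"
      using that by (simp add: skew bracket_simps)
    ultimately show ?thesis
      by (rule abelian_ideal_eq_0[OF rad])
  qed

  \<comment> \<open>By \<open>T4\<close>, \<open>T\<^sup>2\<close> kills
    \<open>T\<^sup>2 x - x\<close>, hence so does \<open>T\<close>.\<close>
  have T3: "T (T (T x)) = T x" for x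
    using ker[of "T (T x) - x"] T4[of x] by (simp add: T_diff)
  \<comment> \<open>\<open>[T\<^sup>2 x, T\<^sup>2 y] = - [T x, T\<^sup>3 y] = - [T x, T y]\<close>;
    perfectness extends this from brackets to all elements.\<close>
  have "T (T (bracket x y)) = - T (bracket x y)" for x y
    by (simp add: hom skew[of "T x" "T (T y)"] T3)
  then have "{bracket x y | x y. x \<in> UNIV \<and> y \<in> UNIV} \<subseteq> {w. T (T w) = - T w}"
    by auto
  moreover have "subspace {w. T (T w) = - T w}"
    by (auto simp: subspace_def T_0 T_add T_scale)
  ultimately have "lie_product UNIV UNIV \<subseteq> {w. T (T w) = - T w}"
    unfolding lie_product_def by (rule span_minimal)
  then have T2: "T (T w) = - T w" for w
    using perfect by (auto simp: lie_perfect_def)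
  show "T x = 0"
  proof (rule centre)
    fix y
    \<comment> \<open>Using \<open>T\<^sup>2 = - T\<close> in the left argument, then in the right
      one, gives \<open>[T x, T y]\<close> two values of opposite sign.\<close>
    have "bracket (T x) y = bracket (T x) (T y)"
      using skew[of "T x" y] by (simp add: T2 bracket_simps)
    also have "\<dots> = - bracket (T x) y"
      using skew[of x "T y"] skew[of x y] by (simp add: T2 bracket_simps)
    finally have "bracket (T x) y + bracket (T x) y = 0"
      by (simp only: eq_neg_iff_add_eq_0)
    then have "scale 2 (bracket (T x) y) = 0"
      using scale_left_distrib[of 1 1 "bracket (T x) y"] by simp
    then show "bracket (T x) y = 0"
      using char by simp
  qed
qed

section \<open>From post-Lie structures to skew endomorphisms\<close>

lemma commutative_post_lie_trivial:
  assumes char: "(2::'k) \<noteq> 0" and perfect: "lie_perfect UNIV"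
    and rad: "solvable_radical {0} UNIV"
    and inner: "\<And>D. derivation D \<Longrightarrow> inner_derivation D"
    and p: "commutative_post_lie p"
  shows "p x y = 0"
proof -
  have p_linear: "\<And>x. Vector_Spaces.linear scale scale (p x)"
      "\<And>y. Vector_Spaces.linear scale scale (\<lambda>x. p x y)"
    and p_commute: "\<And>x y. p x y = p y x"
    and p_bracket: "\<And>x y z. p (bracket x y) z = p x (p y z) - p y (p x z)"
    and p_derivation: "\<And>x y z. p x (bracket y z) = bracket (p x y) z + bracket y (p x z)"
    using p unfolding commutative_post_lie_def bilinear_product_def by blast+
  have "inner_derivation (p x)" for x
    using p_linear(1) p_derivation by (intro inner) (simp add: derivation_def)
  then have "\<forall>x. \<exists>z. p x = bracket z"
    by (simp add: inner_derivation_def)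
  then obtain T where T: "\<And>x. p x = bracket (T x)"
    using choice[of "\<lambda>x z. p x = bracket z"] by blast
  \<comment> \<open>Since \<open>ad\<close> is injective, linearity and multiplicativity of
    \<open>T\<close> can be checked on the operators \<open>p x = ad (T x)\<close>.\<close>
  have eqI: "u = v" if "\<And>y. bracket u y = bracket v y" for u v
    using centre_eq_0[OF rad subspace_UNIV UNIV_I, of "u - v"] that by (simp add: bracket_simps)
  have add: "bracket (T (x + y)) z = bracket (T x) z + bracket (T y) z"
    and scale: "bracket (T (scale c x)) z = scale c (bracket (T x) z)" for c x y z
    using p_linear(2)[of z] by (simp_all add: T Vector_Spaces.linear_iff)
  have "T x = 0"
  proof (rule skew_endomorphism_eq_0[OF char perfect rad, where T = T])
    show "Vector_Spaces.linear scale scale T"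
      unfolding Vector_Spaces.linear_iff
    proof (intro conjI allI)
      show "vector_space scale" "vector_space scale"
        by unfold_locales
      show "T (x + y) = T x + T y" for x y
        by (rule eqI) (simp add: add bracket_simps)
      show "T (scale c x) = scale c (T x)" for c x
        by (rule eqI) (simp add: scale bracket_simps)
    qed
    show "T (bracket x y) = bracket (T x) (T y)" for x y
      by (rule eqI) (use p_bracket in \<open>simp add: T jacobi_left\<close>)
    show "bracket (T x) y = - bracket x (T y)" for x y
      using p_commute[of x y] bracket_anticomm[of "T y" x] by (simp add: T)
  qed
  then show ?thesis
    by (simp add: T bracket_simps)
qed

end

theorem theorem5p20:
  fixes scale :: "complex \<Rightarrow> 'g::ab_group_add \<Rightarrow> 'g"
    and bracket :: "'g \<Rightarrow> 'g \<Rightarrow> 'g"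
    and \<aa> \<ss> :: "'g set"
    and p :: "'g \<Rightarrow> 'g \<Rightarrow> 'g"
  assumes "lie_algebra scale bracket"
    and "\<exists>B. finite_dimensional_vector_space scale B"
    and "lie_algebra.lie_perfect scale bracket UNIV"
    and "lie_algebra.semidirect_decomposition scale bracket \<aa> \<ss>"
    and "lie_algebra.lie_semisimple scale bracket \<ss>"
    and "lie_algebra.solvable_radical scale bracket \<aa> UNIV"
    and "lie_algebra.lie_abelian bracket \<aa>"
    and "\<And>D. lie_algebra.derivation scale bracket D \<Longrightarrow> lie_algebra.inner_derivation bracket D"
    and "lie_algebra.commutative_post_lie scale bracket p"
  shows "\<forall>x y. p x y = 0"
proof -
  interpret lie_algebra scale bracket
    by fact
  have "\<aa> = {0}"
    by (rule abelian_complement_eq_0[OF assms(4,5,7,8)])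
  then have "solvable_radical {0} UNIV"
    using assms(6) by simp
  then show ?thesis
    using commutative_post_lie_trivial[OF _ assms(3) _ assms(8,9)] by simp
qed

end
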